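(* Let $M,K,S\ge1$ be integers, $\sigma^2>0$, $P_{\mathrm{tot}}>0$, $\mathrm{EVM}\in[0,1]$, $\kappa=1-\mathrm{EVM}^2$, and for $\nu=0,\dots,S-1$ let $\bar{\mathbf H}[\nu]=[\bar{\mathbf h}_1[\nu],\dots,\bar{\mathbf h}_K[\nu]]\in\mathbb{C}^{M\times K}$. Let $R_\Sigma^{\mathrm{DL,DPC}}$ be the maximum downlink sum rate with dirty paper coding under hardware distortion and total power $P_{\mathrm{tot}}$, as defined in the context. Then $R_\Sigma^{\mathrm{DL,DPC}}$ equals the optimal value of the dual uplink problem $$\max_{\{\mathbf D_\rho[\nu]\}}\ \frac1S\sum_{\nu=0}^{S-1}\Big[\log_2\det\Big(\mathbf I_M+\frac1{\sigma^2}\bar{\mathbf H}[\nu]\mathbf D_\rho[\nu]\bar{\mathbf H}[\nu]^{\mathrm H}\Big)-\log_2\det\Big(\mathbf I_M+\frac{1-\kappa}{\sigma^2}\bar{\mathbf H}[\nu]\mathbf D_\rho[\nu]\bar{\mathbf H}[\nu]^{\mathrm H}\Big)\Big]$$ where the maximum is over all diagonal matrices $\mathbf D_\rho[\nu]\in\mathbb{R}^{K\times K}$, $\nu=0,\dots,S-1$, with $\mathbf D_\rho[\nu]\succeq 0$ and $\sum_{\nu=0}^{S-1}\mathrm{tr}(\mathbf D_\rho[\nu])\le P_{\mathrm{tot}}$.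
   Context: $(\cdot)^{\mathrm H}$ denotes the conjugate transpose. Downlink model: on subcarrier $\nu$ the $M$-antenna base station transmits $\sum_{i=1}^K\mathbf p_i[\nu]d_i[\nu]$, where $\mathbf p_i[\nu]\in\mathbb{C}^M$ is the precoding vector of user $i$ and the $d_i[\nu]$ are independent unit-variance data signals. With ideal hardware user $k$ would receive $y_k^{\mathrm{ideal}}[\nu]=\sum_{i}\bar{\mathbf h}_k[\nu]^{\mathrm H}\mathbf p_i[\nu]d_i[\nu]+n_k[\nu]$, with noise $n_k[\nu]\sim\mathcal{CN}(0,\sigma^2)$. With hardware distortion at the users, user $k$ receives $\sqrt{\kappa}\,y_k^{\mathrm{ideal}}[\nu]+\eta_k[\nu]$, where $\eta_k[\nu]$ is uncorrelated with $y_k^{\mathrm{ideal}}[\nu]$ and has variance $(1-\kappa)\mathbb{E}|y_k^{\mathrm{ideal}}[\nu]|^2=(1-\kappa)\big(\sum_{i=1}^K|\bar{\mathbf h}_k[\nu]^{\mathrm H}\mathbf p_i[\nu]|^2+\sigma^2\big)$; the distortion is treated as Gaussian noise. Dirty paper coding (DPC): the users are encoded successively on each subcarrier according to a permutation $\pi_\nu$ of $\{1,\dots,K\}$ ($\pi_\nu(i)$ is the position of user $i$), and the data interference caused to user $k$ by users encoded earlier is perfectly pre-cancelled, while the distortion (proportional to the total received power) is not. The resulting rate of user $k$ on subcarrier $\nu$ is $\log_2(1+\mathrm{SINR}_k[\nu])$ with $$\mathrm{SINR}_k[\nu]=\frac{\kappa|\bar{\mathbf h}_k[\nu]^{\mathrm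 H}\mathbf p_k[\nu]|^2}{\sum_{i:\pi_\nu(i)>\pi_\nu(k)}|\bar{\mathbf h}_k[\nu]^{\mathrm H}\mathbf p_i[\nu]|^2+(1-\kappa)\sum_{i:\pi_\nu(i)\le\pi_\nu(k)}|\bar{\mathbf h}_k[\nu]^{\mathrm H}\mathbf p_i[\nu]|^2+\sigma^2}.$$ $R_\Sigma^{\mathrm{DL,DPC}}$ is the maximum of $\frac1S\sum_{\nu=0}^{S-1}\sum_{k=1}^K\log_2(1+\mathrm{SINR}_k[\nu])$ over all encoding orders $\pi_\nu$ and all precoding vectors satisfying $\sum_{\nu=0}^{S-1}\sum_{i=1}^K\|\mathbf p_i[\nu]\|^2\le P_{\mathrm{tot}}$. The objective of the dual uplink problem is the uplink sum rate with successive interference cancellation when user $k$ transmits on subcarrier $\nu$ with power equal to the $k$-th diagonal entry of $\mathbf D_\rho[\nu]$, a fraction $1-\kappa=\mathrm{EVM}^2$ of which is distortion. *)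

theory Defs
  imports "HOL-Analysis.Analysis"
begin

text \<open>
  Antennas are indexed by \<open>'m\<close> and users by \<open>'k\<close> (so the number of antennas is \<open>CARD('m)\<close> and the
  number of users is \<open>CARD('k)\<close>, both at least 1); subcarriers are the numbers \<open>\<nu> < S\<close>. A channel
  matrix has type \<open>complex ^ 'k ^ 'm\<close>, and its \<open>k\<close>-th column is the channel vector of user \<open>k\<close>.
  Throughout, \<open>s2\<close> is the noise variance (not the standard deviation).
\<close>

definition conj_transpose :: "complex ^ 'n ^ 'm \<Rightarrow> complex ^ 'm ^ 'n"
  where "conj_transpose A = map_matrix cnj (transpose A)"

definition herm_prod :: "complex ^ 'm \<Rightarrow> complex ^ 'm \<Rightarrow> complex"
  where "herm_prod h p = (\<Sum>m\<in>UNIV. cnj (h $ m) * p $ m)"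

definition is_diagonal :: "real ^ 'k ^ 'k \<Rightarrow> bool"
  where "is_diagonal D \<longleftrightarrow> (\<forall>i j. i \<noteq> j \<longrightarrow> D $ i $ j = 0)"

definition is_psd :: "real ^ 'k ^ 'k \<Rightarrow> bool"
  where "is_psd D \<longleftrightarrow> transpose D = D \<and> (\<forall>x. 0 \<le> x \<bullet> (D *v x))"

definition is_maximum :: "real set \<Rightarrow> real \<Rightarrow> bool"
  where "is_maximum V v \<longleftrightarrow> v \<in> V \<and> (\<forall>w\<in>V. w \<le> v)"


subsection \<open>Downlink with dirty paper coding under hardware distortion\<close>

text \<open>\<open>ord i\<close> is the position of user \<open>i\<close> in the encoding order.\<close>

definition encoding_order :: "('k::finite \<Rightarrow> nat) \<Rightarrow> bool"
  where "encoding_order ord \<longleftrightarrow> bij_betw ord UNIV {1..CARD('k)}"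

text \<open>
  Data interference from users encoded before \<open>k\<close> is cancelled; their distortion and the
  self-distortion (\<open>i = k\<close> in the second sum) are not.
\<close>

definition dl_sinr ::
  "real \<Rightarrow> real \<Rightarrow> complex ^ 'k ^ 'm \<Rightarrow> ('k \<Rightarrow> nat) \<Rightarrow> ('k \<Rightarrow> complex ^ 'm) \<Rightarrow> 'k::finite \<Rightarrow> real"
  where "dl_sinr \<kappa> s2 H ord p k =
    \<kappa> * (cmod (herm_prod (column k H) (p k)))\<^sup>2 /
    ((\<Sum>i | ord i > ord k. (cmod (herm_prod (column k H) (p i)))\<^sup>2)
      + (1 - \<kappa>) * (\<Sum>i | ord i \<le> ord k. (cmod (herm_prod (column k H) (p i)))\<^sup>2)
      + s2)"

definition dl_sum_rate ::
  "nat \<Rightarrow> real \<Rightarrow> real \<Rightarrow> (nat \<Rightarrow> complex ^ 'k ^ 'm) \<Rightarrow> (nat \<Rightarrow> 'k::finite \<Rightarrow> nat) \<Rightarrow>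
   (nat \<Rightarrow> 'k \<Rightarrow> complex ^ 'm) \<Rightarrow> real"
  where "dl_sum_rate S \<kappa> s2 H ord p =
    1 / real S * (\<Sum>\<nu><S. \<Sum>k\<in>UNIV. log 2 (1 + dl_sinr \<kappa> s2 (H \<nu>) (ord \<nu>) (p \<nu>) k))"

definition dl_feasible ::
  "nat \<Rightarrow> real \<Rightarrow> (nat \<Rightarrow> 'k::finite \<Rightarrow> nat) \<Rightarrow> (nat \<Rightarrow> 'k \<Rightarrow> complex ^ 'm) \<Rightarrow> bool"
  where "dl_feasible S Ptot ord p \<longleftrightarrow>
    (\<forall>\<nu><S. encoding_order (ord \<nu>)) \<and> (\<Sum>\<nu><S. \<Sum>i\<in>UNIV. (norm (p \<nu> i))\<^sup>2) \<le> Ptot"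

definition dl_rates ::
  "nat \<Rightarrow> real \<Rightarrow> real \<Rightarrow> real \<Rightarrow> (nat \<Rightarrow> complex ^ 'k::finite ^ 'm) \<Rightarrow> real set"
  where "dl_rates S \<kappa> s2 Ptot H = {dl_sum_rate S \<kappa> s2 H ord p | ord p. dl_feasible S Ptot ord p}"

definition R_dl_dpc ::
  "nat \<Rightarrow> real \<Rightarrow> real \<Rightarrow> real \<Rightarrow> (nat \<Rightarrow> complex ^ 'k::finite ^ 'm) \<Rightarrow> real"
  where "R_dl_dpc S \<kappa> s2 Ptot H = Sup (dl_rates S \<kappa> s2 Ptot H)"


subsection \<open>Dual uplink problem\<close>

text \<open>
  The determinant of \<open>I + c H D H\<^sup>H\<close> is a complex number that is real and positive for \<open>c \<ge> 0\<close> and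
  positive semidefinite \<open>D\<close>, because the matrix is Hermitian and positive definite; \<open>Re\<close> only
  converts the type.
\<close>

definition log2_det :: "complex ^ 'm ^ 'm \<Rightarrow> real"
  where "log2_det A = log 2 (Re (det A))"

definition ul_matrix ::
  "real \<Rightarrow> complex ^ 'k ^ 'm \<Rightarrow> real ^ 'k ^ 'k \<Rightarrow> complex ^ 'm ^ 'm"
  where "ul_matrix c H D = mat 1 + c *\<^sub>R (H ** map_matrix complex_of_real D ** conj_transpose H)"

definition ul_objective ::
  "nat \<Rightarrow> real \<Rightarrow> real \<Rightarrow> (nat \<Rightarrow> complex ^ 'k ^ 'm) \<Rightarrow> (nat \<Rightarrow> real ^ 'k ^ 'k) \<Rightarrow> real"
  where "ul_objective S \<kappa> s2 H D =
    1 / real S * (\<Sum>\<nu><S. log2_det (ul_matrix (1 / s2) (H \<nu>) (D \<nu>))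
                          - log2_det (ul_matrix ((1 - \<kappa>) / s2) (H \<nu>) (D \<nu>)))"

definition ul_feasible :: "nat \<Rightarrow> real \<Rightarrow> (nat \<Rightarrow> real ^ 'k ^ 'k) \<Rightarrow> bool"
  where "ul_feasible S Ptot D \<longleftrightarrow>
    (\<forall>\<nu><S. is_diagonal (D \<nu>) \<and> is_psd (D \<nu>)) \<and> (\<Sum>\<nu><S. trace (D \<nu>)) \<le> Ptot"

definition ul_values ::
  "nat \<Rightarrow> real \<Rightarrow> real \<Rightarrow> real \<Rightarrow> (nat \<Rightarrow> complex ^ 'k ^ 'm) \<Rightarrow> real set"
  where "ul_values S \<kappa> s2 Ptot H = {ul_objective S \<kappa> s2 H D | D. ul_feasible S Ptot D}"

definition ul_optimal_value ::
  "nat \<Rightarrow> real \<Rightarrow> real \<Rightarrow> real \<Rightarrow> (nat \<Rightarrow> complex ^ 'k ^ 'm) \<Rightarrow> real"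
  where "ul_optimal_value S \<kappa> s2 Ptot H = Sup (ul_values S \<kappa> s2 Ptot H)"

end

(*
  The uplink sum rate telescopes: raising the users one at a time, in the encoding order, from the
  distortion level (1 - kappa) rho_k to the full power rho_k multiplies the determinant of the
  receive covariance by 1 + gamma_k (rank-one update), where gamma_k is the SINR of user k with the
  optimal linear receive filter. With unit-norm filters w_k reused as transmit directions, the
  coupling of user i into user k in the downlink is the coupling of user k into user i in the
  uplink, distortion included, so both power control problems are governed by a Z-matrix and its
  transpose. Such a matrix with a positive supersolution is inverse-nonnegative, and pairing the
  two solutions shows that the same SINRs are reached with the same total power. Hence each
  downlink rate is dominated by an uplink value and conversely; the uplink maximum exists by
  compactness and is therefore also the downlink maximum.
*)

theory Submission
  imports Defs
begin

section \<open>Determinant of a rank-one perturbation of the identity\<close>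

text \<open>The rows are perturbed one at a time. The determinant is linear in row \<open>k\<close>:
  the unit-vector part reproduces the previous determinant, and the part \<open>u $ k *s v\<close>
  adds \<open>u $ k * v $ k\<close>.\<close>

lemma det_add_rank_one:
  fixes u v :: "'a::field ^ 'n"
  shows "det (mat 1 + (\<chi> i j. u $ i * v $ j)) = 1 + (\<Sum>i\<in>UNIV. u $ i * v $ i)"
proof -
  have step: "det (\<chi> i. if i \<in> T then axis i 1 + u $ i *s v else axis i 1) = 1 + (\<Sum>i\<in>T. u $ i * v $ i)"
    if "finite T" for T :: "'n set"
    using that
  proof (induction T)
    case empty
    have "(\<chi> i. axis i 1) = (mat 1 :: 'a ^ 'n ^ 'n)"
      by (simp add: vec_eq_iff mat_def axis_def)
    then show ?case by simp
  next
    case (insert k T)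
    define r where "r = (\<lambda>i. if i \<in> T then axis i 1 + u $ i *s v else (axis i 1 :: 'a ^ 'n))"
    have "det (\<chi> i. if i \<in> insert k T then axis i 1 + u $ i *s v else axis i 1)
        = det (\<chi> i. if i = k then axis k 1 + u $ k *s v else r i)"
      by (rule arg_cong[of _ _ det]) (auto simp: vec_eq_iff r_def)
    also have "\<dots> = det (\<chi> i. if i = k then axis k 1 else r i) + u $ k * det (\<chi> i. if i = k then v else r i)"
      by (subst det_row_add) (simp add: det_row_mul)
    also have "(\<chi> i. if i = k then axis k 1 else r i) = (\<chi> i. r i)"
      using insert.hyps by (auto simp: vec_eq_iff r_def)
    also have "det (\<chi> i. r i) = 1 + (\<Sum>i\<in>T. u $ i * v $ i)"
      using insert.IH by (simp add: r_def)
    also have "det (\<chi> i. if i = k then v else r i) = v $ k"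
    proof -
      \<comment> \<open>With \<open>v\<close> itself as row \<open>k\<close>, the multiples of
        \<open>v\<close> in the other rows can be removed by row operations. What is left is the
        identity with row \<open>k\<close> replaced by \<open>v\<close>, whose determinant is
        \<open>v $ k\<close> by Cramer's rule.\<close>
      have elim: "det (\<chi> i. if i = k then v else if i \<in> T' then axis i 1 + u $ i *s v else axis i 1) = v $ k"
        if "finite T'" "k \<notin> T'" for T'
        using that
      proof (induction T')
        case empty
        have row_mat: "row i (mat 1) = (axis i 1 :: 'a ^ 'n)" for i
          by (simp add: vec_eq_iff row_def mat_def axis_def)
        have "det (\<chi> i. if i = k then v else axis i 1) = v $ k"
          using cramer_lemma_transpose[of k v "mat 1 :: 'a ^ 'n ^ 'n"]
          unfolding row_mat basis_expansion det_I mult_1_right .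
        then show ?case
          by (simp cong: if_cong)
      next
        case (insert j T')
        let ?A = "\<chi> i. if i = k then v else if i \<in> T' then axis i 1 + u $ i *s v else (axis i 1 :: 'a ^ 'n)"
        have "j \<noteq> k" using insert by auto
        have "(\<chi> i. if i = k then v else if i \<in> insert j T' then axis i 1 + u $ i *s v else axis i 1)
            = (\<chi> i. if i = j then row j ?A + u $ j *s row k ?A else row i ?A)"
          using insert \<open>j \<noteq> k\<close> by (auto simp: vec_eq_iff row_def)
        then show ?case
          using det_row_operation[OF \<open>j \<noteq> k\<close>, of ?A "u $ j"] insert by simp
      qed
      show ?thesis
        unfolding r_def using elim[of T] insert.hyps by blast
    qed
    finally show ?case
      using insert.hyps by (simp add: algebra_simps)
  qed
  have "mat 1 + (\<chi> i j. u $ i * v $ j) = (\<chi> i. if i \<in> UNIV then axis i 1 + u $ i *s v else axis i 1)"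
    unfolding vec_eq_iff by (simp add: mat_def axis_def)
  then show ?thesis
    using step[of UNIV] by (metis finite)
qed

section \<open>The receive covariance and its Hermitian form\<close>

text \<open>This is I + H diag(c) H^H, the receive covariance in units of the noise power. The loads
  form a function rather than a diagonal matrix, so that they can be changed one user at a
  time.\<close>

definition cov :: "('k \<Rightarrow> real) \<Rightarrow> complex ^ 'k ^ 'm \<Rightarrow> complex ^ 'm ^ 'm"
  where "cov c H = (\<chi> a b. (if a = b then 1 else 0) + (\<Sum>i\<in>UNIV. of_real (c i) * H $ a $ i * cnj (H $ b $ i)))"

lemma herm_prod_add: "herm_prod h (p + q) = herm_prod h p + herm_prod h q"
  by (simp add: herm_prod_def algebra_simps sum.distrib)

lemma herm_prod_add_left: "herm_prod (g + h) p = herm_prod g p + herm_prod h p"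
  by (simp add: herm_prod_def algebra_simps sum.distrib)

lemma herm_prod_scale: "herm_prod h (a *s p) = a * herm_prod h p"
  by (simp add: herm_prod_def algebra_simps sum_distrib_left)

lemma herm_prod_scale_left: "herm_prod (a *s h) p = cnj a * herm_prod h p"
  by (simp add: herm_prod_def algebra_simps sum_distrib_left)

lemma herm_prod_zero [simp]: "herm_prod h 0 = 0" "herm_prod 0 h = 0"
  by (simp_all add: herm_prod_def)

lemma herm_prod_sum: "herm_prod h (\<Sum>i\<in>I. f i) = (\<Sum>i\<in>I. herm_prod h (f i))"
  by (induction I rule: infinite_finite_induct) (auto simp: herm_prod_add)

lemma cnj_herm_prod: "cnj (herm_prod h p) = herm_prod p h"
  by (simp add: herm_prod_def mult.commute)

lemma herm_prod_self: "herm_prod w w = of_real ((norm w)\<^sup>2)"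
  by (simp add: herm_prod_def norm_vec_def L2_set_def sum_nonneg complex_norm_square mult.commute
      del: of_real_power)

lemma cov_mult_vec: "cov c H *v w = w + (\<Sum>i\<in>UNIV. (of_real (c i) * herm_prod (column i H) w) *s column i H)"
proof -
  have "(\<Sum>b\<in>UNIV. (\<Sum>i\<in>UNIV. of_real (c i) * H $ a $ i * cnj (H $ b $ i)) * w $ b)
      = (\<Sum>i\<in>UNIV. of_real (c i) * (\<Sum>b\<in>UNIV. cnj (H $ b $ i) * w $ b) * H $ a $ i)" for a
    unfolding sum_distrib_left sum_distrib_right
    by (subst sum.swap) (simp add: mult_ac)
  then show ?thesis
    by (simp add: vec_eq_iff matrix_vector_mult_def cov_def column_def herm_prod_def
        distrib_right sum.distrib if_distrib[of "\<lambda>x. x * _"] cong: if_cong)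
qed

lemma herm_prod_cov:
  "herm_prod v (cov c H *v w) = herm_prod v w
    + (\<Sum>i\<in>UNIV. of_real (c i) * herm_prod v (column i H) * herm_prod (column i H) w)"
  by (simp add: cov_mult_vec herm_prod_add herm_prod_sum herm_prod_scale mult_ac)

lemma herm_prod_cov_swap: "herm_prod v (cov c H *v w) = herm_prod (cov c H *v v) w"
proof -
  have "cnj (herm_prod w (cov c H *v v)) = herm_prod v (cov c H *v w)"
    by (simp add: herm_prod_cov cnj_herm_prod mult_ac)
  then show ?thesis by (simp add: cnj_herm_prod)
qed

text \<open>The quadratic form w^H C w of C = \<open>cov c H\<close>, as a real number: noise plus
  received power at the output of the linear filter \<open>w\<close>.\<close>

definition power_form :: "('k \<Rightarrow> real) \<Rightarrow> complex ^ 'k ^ 'm \<Rightarrow> complex ^ 'm \<Rightarrow> real"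
  where "power_form c H w = (norm w)\<^sup>2 + (\<Sum>i\<in>UNIV. c i * (cmod (herm_prod (column i H) w))\<^sup>2)"

lemma herm_prod_cov_self: "herm_prod w (cov c H *v w) = of_real (power_form c H w)"
proof -
  have "herm_prod w (column i H) * herm_prod (column i H) w = of_real ((cmod (herm_prod (column i H) w))\<^sup>2)" for i
    by (subst cnj_herm_prod[symmetric], subst mult.commute, rule complex_norm_square[symmetric])
  then show ?thesis
    by (simp add: herm_prod_cov power_form_def herm_prod_self mult.assoc)
qed

lemma power_form_ge: "(\<And>i. c i \<ge> 0) \<Longrightarrow> power_form c H w \<ge> (norm w)\<^sup>2"
  by (simp add: power_form_def sum_nonneg)

lemma power_form_nonneg: "(\<And>i. c i \<ge> 0) \<Longrightarrow> power_form c H w \<ge> 0"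
  by (rule order_trans[OF zero_le_power2 power_form_ge])

text \<open>The form of \<open>cov c H\<close> dominates the squared norm, so the kernel is
  trivial.\<close>

lemma cov_solvable:
  fixes H :: "complex ^ 'k::finite ^ 'm::finite"
  assumes "\<And>i. c i \<ge> 0"
  obtains u where "cov c H *v u = h"
proof -
  have "w = 0" if "cov c H *v w = 0" for w
  proof -
    have "power_form c H w = 0"
      using herm_prod_cov_self[of w c H] that by simp
    then show "w = 0"
      using power_form_ge[of c w H] assms by simp
  qed
  then obtain B where "B ** cov c H = mat 1"
    using matrix_left_invertible_ker[of "cov c H"] by blast
  then have "cov c H ** B = mat 1"
    by (simp add: matrix_left_right_inverse)
  then have "cov c H *v (B *v h) = h"
    by (simp add: matrix_vector_mul_assoc)
  then show ?thesis by (rule that)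
qed

text \<open>With C = \<open>cov c H\<close> and u = C^-1 h, this identifies h^H C^-1 h with
  \<open>power_form c H u\<close>. Below, that value stands for the normalised SINR of the optimal
  filter, without any explicit inverse.\<close>

lemma herm_prod_solution:
  assumes "cov c H *v u = h"
  shows "herm_prod h u = of_real (power_form c H u)"
  using herm_prod_cov_self[of u c H] herm_prod_cov_swap[of u c H u] assms by simp

text \<open>Cauchy-Schwarz for the inner product induced by \<open>cov c H\<close>, in which
  \<open>herm_prod h w\<close> is the product of \<open>u\<close> and \<open>w\<close>. It bounds
  the output SINR of every filter \<open>w\<close> by that of \<open>u\<close>.\<close>

lemma cauchy_schwarz_cov:
  fixes H :: "complex ^ 'k::finite ^ 'm::finite"
  assumes c: "\<And>i. c i \<ge> 0" and u: "cov c H *v u = h"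
  shows "(cmod (herm_prod h w))\<^sup>2 \<le> power_form c H u * power_form c H w"
proof (cases "u = 0")
  case True
  then have "h = 0" using u by simp
  then show ?thesis using True by (simp add: power_form_def)
next
  case False
  define e f where "e = power_form c H u" and "f = herm_prod h w"
  have "e > 0"
    using power_form_ge[of c u H] c False unfolding e_def
    by (metis less_le_trans zero_less_norm_iff zero_less_power)
  \<comment> \<open>The minimiser of the nonnegative quadratic that maps \<open>t\<close> to
    \<open>power_form c H (w + t *s u)\<close>.\<close>
  define t where "t = - f / of_real e"
  have 1: "herm_prod u (cov c H *v w) = f"
    by (simp add: herm_prod_cov_swap u f_def)
  have 2: "herm_prod w h = cnj f" "herm_prod u h = of_real e"
    using herm_prod_solution[OF u]
    by (simp_all add: f_def e_def cnj_herm_prod) (metis cnj_herm_prod complex_cnj_complex_of_real)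
  have "of_real (power_form c H (w + t *s u)) = herm_prod (w + t *s u) (cov c H *v (w + t *s u))"
    by (simp add: herm_prod_cov_self)
  also have "\<dots> = of_real (power_form c H w) + t * cnj f + cnj t * f + cnj t * t * of_real e"
    by (simp add: matrix_vector_mult_add_rdistrib vec.add vec.scale u 1 2 herm_prod_cov_self herm_prod_add
        herm_prod_add_left herm_prod_scale herm_prod_scale_left algebra_simps)
  also have "\<dots> = of_real (power_form c H w) - f * cnj f / of_real e"
    using \<open>e > 0\<close> by (simp add: t_def field_simps)
  also have "f * cnj f = of_real ((cmod f)\<^sup>2)"
    by (rule complex_norm_square[symmetric])
  finally have "power_form c H (w + t *s u) = power_form c H w - (cmod f)\<^sup>2 / e"
    by (metis of_real_diff of_real_divide of_real_eq_iff)
  moreover have "0 \<le> power_form c H (w + t *s u)"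
    using c by (rule power_form_nonneg)
  ultimately have "(cmod f)\<^sup>2 / e \<le> power_form c H w"
    by linarith
  then show ?thesis
    using \<open>e > 0\<close> by (simp add: e_def[symmetric] f_def[symmetric] field_simps)
qed

text \<open>Since \<open>u\<close> solves the system for h = \<open>column k H\<close>, the new
  covariance factors as \<open>cov c H\<close> times I + a u h^H, and the rank-one determinant
  formula applies to the second factor.\<close>

lemma det_cov_add_user:
  fixes H :: "complex ^ 'k::finite ^ 'm::finite"
  assumes u: "cov c H *v u = column k H" and "d k = c k + a" and "\<And>i. i \<noteq> k \<Longrightarrow> d i = c i"
  shows "det (cov d H) = det (cov c H) * of_real (1 + a * power_form c H u)"
proof -
  let ?h = "column k H"
  let ?R = "mat 1 + (\<chi> i j. (of_real a *s u) $ i * (\<chi> j. cnj (?h $ j)) $ j) :: complex ^ 'm ^ 'm"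
  have "cov d H = cov c H ** ?R"
  proof -
    have "(cov c H ** (\<chi> i j. (of_real a *s u) $ i * (\<chi> j. cnj (?h $ j)) $ j)) $ x $ y
        = of_real a * (cov c H *v u) $ x * cnj (?h $ y)" for x y
      by (simp add: matrix_matrix_mult_def matrix_vector_mult_def sum_distrib_left sum_distrib_right mult_ac)
    moreover have "cov d H $ x $ y = cov c H $ x $ y + of_real a * ?h $ x * cnj (?h $ y)" for x y
    proof -
      have "(\<Sum>i\<in>UNIV. of_real (d i) * H $ x $ i * cnj (H $ y $ i))
         = (\<Sum>i\<in>UNIV. of_real (c i) * H $ x $ i * cnj (H $ y $ i)
             + (if i = k then of_real a * H $ x $ k * cnj (H $ y $ k) else 0))"
        by (rule sum.cong) (use assms in \<open>auto simp: algebra_simps\<close>)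
      then show ?thesis
        by (simp add: cov_def column_def sum.distrib)
    qed
    ultimately show ?thesis
      by (simp add: vec_eq_iff matrix_add_ldistrib u)
  qed
  moreover have "det ?R = of_real (1 + a * power_form c H u)"
    using herm_prod_solution[OF u]
    by (subst det_add_rank_one) (simp add: herm_prod_def mult_ac sum_distrib_left[symmetric])
  ultimately show ?thesis
    by (simp add: det_mul)
qed

text \<open>Switching the users on one at a time, starting from the identity, multiplies the
  determinant by real factors of at least 1.\<close>

lemma det_cov_pos:
  fixes H :: "complex ^ 'k::finite ^ 'm::finite"
  assumes "\<And>i. c i \<ge> 0"
  shows "\<exists>r>0. det (cov c H) = of_real r"
proof -
  have "\<exists>r>0. det (cov (\<lambda>i. if i \<in> T then c i else 0) H) = of_real r" if "finite T" for T
    using that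
  proof (induction T)
    case empty
    have "cov (\<lambda>i. 0) H = mat 1" by (simp add: cov_def mat_def vec_eq_iff)
    then show ?case by (auto intro!: exI[of _ 1])
  next
    case (insert k T)
    let ?c = "\<lambda>T i. if i \<in> T then c i else 0"
    obtain r where r: "r > 0" "det (cov (?c T) H) = of_real r"
      using insert.IH by blast
    obtain u where u: "cov (?c T) H *v u = column k H"
      by (rule cov_solvable[of "?c T" H "column k H"]) (use assms in auto)
    have "det (cov (?c (insert k T)) H) = of_real r * of_real (1 + c k * power_form (?c T) H u)"
      using insert.hyps r by (subst det_cov_add_user[OF u, of _ "c k"]) auto
    then have "det (cov (?c (insert k T)) H) = of_real (r * (1 + c k * power_form (?c T) H u))"
      by simp
    moreover have "c k * power_form (?c T) H u \<ge> 0"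
      using assms by (intro mult_nonneg_nonneg power_form_nonneg) auto
    then have "r * (1 + c k * power_form (?c T) H u) > 0"
      using r by (intro mult_pos_pos) auto
    ultimately show ?case
      by blast
  qed
  from this[of UNIV] show ?thesis by simp
qed

section \<open>Power control with a coupling matrix and with its transpose\<close>

text \<open>Read \<open>F k i\<close> as the coupling of user \<open>i\<close> into user
  \<open>k\<close>, \<open>g k\<close> as the direct gain and \<open>\<gamma> k\<close> as the
  target SINR, all multiplied out to avoid quotients. The new powers solve the transposed system
  with equality on the users with positive target.\<close>

lemma power_duality:
  fixes F :: "'k::finite \<Rightarrow> 'k \<Rightarrow> real"
  assumes F: "\<And>k i. F k i \<ge> 0" and \<gamma>: "\<And>k. \<gamma> k \<ge> 0" and "s > 0" and q: "\<And>k. q k \<ge> 0"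
    and target: "\<And>k. \<gamma> k * ((\<Sum>i\<in>UNIV. F k i * q i) + s) \<le> g k * q k"
  obtains \<rho> where "\<And>k. \<rho> k \<ge> 0" "(\<Sum>k\<in>UNIV. \<rho> k) \<le> (\<Sum>k\<in>UNIV. q k)"
    "\<And>k. \<gamma> k * ((\<Sum>i\<in>UNIV. F i k * \<rho> i) + s) \<le> g k * \<rho> k"
proof -
  define J where "J = {k. \<gamma> k > 0}"
  \<comment> \<open>Users with zero target are switched off: dividing by their target is meaningless, so they
    get an identity block, decoupled from the rest.\<close>
  define A where "A i k = (if k \<in> J \<and> i \<in> J then (if k = i then g k / \<gamma> k else 0) - F i k else if k = i then 1 else 0)" for i k
  \<comment> \<open>The value 1 outside \<open>J\<close> makes the identity block contribute
    positive row sums, so \<open>x\<close> is a strict supersolution in every row.\<close>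
  define x where "x i = (if i \<in> J then q i else 1)" for i
  have A_off: "A i k \<le> 0" if "i \<noteq> k" for i k
    using that F by (auto simp: A_def)
  have x0: "x i \<ge> 0" for i using q by (simp add: x_def)
  \<comment> \<open>On \<open>J\<close> this is the target inequality divided by
    \<open>\<gamma> i\<close>; omitting the interferers outside \<open>J\<close> only helps.\<close>
  have Aq: "(\<Sum>k\<in>UNIV. A i k * x k) \<ge> s" if "i \<in> J" for i
  proof -
    have "(\<Sum>k\<in>UNIV. A i k * x k) = (\<Sum>k\<in>J. A i k * q k)"
      using that by (intro sum.mono_neutral_cong_right) (auto simp: A_def x_def)
    also have "\<dots> = (\<Sum>k\<in>J. (if k = i then g i * q i / \<gamma> i else 0) - F i k * q k)"
      by (rule sum.cong) (use that in \<open>auto simp: A_def algebra_simps\<close>)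
    also have "\<dots> = g i * q i / \<gamma> i - (\<Sum>k\<in>J. F i k * q k)"
      using that by (simp add: sum_subtractf)
    also have "\<dots> \<ge> g i * q i / \<gamma> i - (\<Sum>k\<in>UNIV. F i k * q k)"
      using F q by (intro diff_left_mono sum_mono2) auto
    finally have "(\<Sum>k\<in>UNIV. A i k * x k) \<ge> g i * q i / \<gamma> i - (\<Sum>k\<in>UNIV. F i k * q k)" .
    moreover have "s \<le> g i * q i / \<gamma> i - (\<Sum>k\<in>UNIV. F i k * q k)"
      using target[of i] that by (simp add: J_def field_simps)
    ultimately show ?thesis by linarith
  qed
  have Aq': "(\<Sum>k\<in>UNIV. A i k * x k) = 1" if "i \<notin> J" for i
  proof -
    have "(\<Sum>k\<in>UNIV. A i k * x k) = (\<Sum>k\<in>UNIV. if k = i then 1 else 0)"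
      by (rule sum.cong) (use that in \<open>auto simp: A_def x_def\<close>)
    then show ?thesis by simp
  qed
  have pos: "(\<Sum>k\<in>UNIV. A i k * x k) > 0" for i
    using Aq[of i] Aq'[of i] \<open>s > 0\<close> by (cases "i \<in> J") auto
  \<comment> \<open>Inverse-nonnegativity of the transpose. If \<open>y\<close> is negative exactly
    on a nonempty \<open>N\<close>, add the inequalities indexed by \<open>N\<close> with weights
    \<open>x\<close>. The coefficient of \<open>y i\<close> is positive for \<open>i\<close> in
    \<open>N\<close>, because the omitted off-diagonal terms are nonpositive, and it is nonpositive
    outside \<open>N\<close>. The sum is then negative, a contradiction.\<close>
  have monotone: "y i \<ge> 0" if y: "\<And>k. (\<Sum>i\<in>UNIV. A i k * y i) \<ge> 0" for y :: "'k \<Rightarrow> real" and i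
  proof (rule ccontr)
    assume "\<not> y i \<ge> 0"
    define N where "N = {i. y i < 0}"
    have "i \<in> N" using \<open>\<not> y i \<ge> 0\<close> by (simp add: N_def)
    have "(\<Sum>k\<in>N. A i k * x k) > 0" if "i \<in> N" for i
    proof -
      have "(\<Sum>k\<in>UNIV. A i k * x k) = (\<Sum>k\<in>N. A i k * x k) + (\<Sum>k\<in>-N. A i k * x k)"
        by (simp add: Compl_eq_Diff_UNIV sum.subset_diff[of N UNIV])
      moreover have "(\<Sum>k\<in>-N. A i k * x k) \<le> 0"
        using that by (intro sum_nonpos mult_nonpos_nonneg A_off x0) auto
      ultimately show ?thesis using pos[of i] by linarith
    qed
    then have neg: "(\<Sum>k\<in>N. A i k * x k) * y i < 0" if "i \<in> N" for i
      using that by (simp add: N_def mult_pos_neg)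
    have nonpos: "(\<Sum>k\<in>N. A i k * x k) * y i \<le> 0" if "i \<notin> N" for i
      using that by (intro mult_nonpos_nonneg sum_nonpos A_off x0) (auto simp: N_def)
    have "0 \<le> (\<Sum>k\<in>N. x k * (\<Sum>i\<in>UNIV. A i k * y i))"
      by (rule sum_nonneg, rule mult_nonneg_nonneg[OF x0 y])
    also have "\<dots> = (\<Sum>i\<in>UNIV. (\<Sum>k\<in>N. A i k * x k) * y i)"
      unfolding sum_distrib_left sum_distrib_right by (subst sum.swap) (simp add: mult_ac)
    also have "\<dots> < (\<Sum>i\<in>(UNIV :: 'k set). 0)"
      using neg nonpos \<open>i \<in> N\<close> by (intro sum_strict_mono_ex1) (auto, metis less_le)
    finally show False by simp
  qed
  define B :: "real ^ 'k ^ 'k" where "B = (\<chi> k i. A i k)"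
  have B: "(B *v y) $ k = (\<Sum>i\<in>UNIV. A i k * y $ i)" for y k
    by (simp add: B_def matrix_vector_mult_def)
  \<comment> \<open>Monotonicity applied to \<open>y\<close> and to its negative shows that the
    transposed matrix \<open>B\<close> is injective, hence invertible.\<close>
  have "y = 0" if "B *v y = 0" for y
  proof -
    have "y $ i \<ge> 0" "- (y $ i) \<ge> 0" for i
      using that monotone[of "\<lambda>i. y $ i" i] monotone[of "\<lambda>i. - (y $ i)" i]
      by (simp_all add: B[symmetric] sum_negf)
    then show "y = 0" by (auto simp: vec_eq_iff intro: antisym)
  qed
  then obtain C where "C ** B = mat 1"
    using matrix_left_invertible_ker[of B] by blast
  then have BC: "B ** C = mat 1"
    by (simp add: matrix_left_right_inverse)
  \<comment> \<open>The right-hand side vanishes outside \<open>J\<close>, which forces the powers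
    of the users with zero target to vanish too.\<close>
  define b where "b k = (if k \<in> J then s else 0)" for k
  define \<rho> where "\<rho> i = (C *v (\<chi> k. b k)) $ i" for i
  have "B *v (C *v (\<chi> k. b k)) = (\<chi> k. b k)"
    by (simp add: matrix_vector_mul_assoc BC)
  then have A\<rho>: "(\<Sum>i\<in>UNIV. A i k * \<rho> i) = b k" for k
    by (simp add: \<rho>_def flip: B)
  have \<rho>0: "\<rho> k \<ge> 0" for k
    by (rule monotone) (use \<open>s > 0\<close> in \<open>simp add: A\<rho> b_def\<close>)
  have out: "\<rho> k = 0" if "k \<notin> J" for k
  proof -
    have "(\<Sum>i\<in>UNIV. A i k * \<rho> i) = (\<Sum>i\<in>UNIV. if i = k then \<rho> k else 0)"
      by (rule sum.cong) (use that in \<open>auto simp: A_def\<close>)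
    then show ?thesis using A\<rho>[of k] that by (simp add: b_def)
  qed
  show ?thesis
  proof (rule that[OF \<rho>0])
    \<comment> \<open>The double sum of \<open>A i k * x k * \<rho> i\<close> is evaluated in both
      orders: summing over \<open>k\<close> first bounds it below by \<open>s\<close> times the sum
      of \<open>\<rho>\<close>, summing over \<open>i\<close> first gives exactly \<open>s\<close>
      times the sum of \<open>q\<close> over \<open>J\<close>.\<close>
    have "s * (\<Sum>k\<in>UNIV. \<rho> k) = (\<Sum>k\<in>J. s * \<rho> k)"
      unfolding sum_distrib_left by (rule sum.mono_neutral_right) (auto simp: out)
    also have "\<dots> \<le> (\<Sum>i\<in>J. (\<Sum>k\<in>UNIV. A i k * x k) * \<rho> i)"
      by (intro sum_mono mult_right_mono Aq \<rho>0)
    also have "\<dots> = (\<Sum>i\<in>UNIV. (\<Sum>k\<in>UNIV. A i k * x k) * \<rho> i)"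
      by (rule sum.mono_neutral_left) (auto simp: out)
    also have "\<dots> = (\<Sum>k\<in>UNIV. x k * (\<Sum>i\<in>UNIV. A i k * \<rho> i))"
      unfolding sum_distrib_left sum_distrib_right by (subst sum.swap) (simp add: mult_ac)
    also have "\<dots> = (\<Sum>k\<in>J. s * q k)"
      by (rule sum.mono_neutral_cong_right) (auto simp: A\<rho> b_def x_def)
    also have "\<dots> \<le> (\<Sum>k\<in>UNIV. s * q k)"
      using \<open>s > 0\<close> q by (intro sum_mono2) auto
    finally show "(\<Sum>k\<in>UNIV. \<rho> k) \<le> (\<Sum>k\<in>UNIV. q k)"
      using \<open>s > 0\<close> by (simp flip: sum_distrib_left)
  next
    fix k
    show "\<gamma> k * ((\<Sum>i\<in>UNIV. F i k * \<rho> i) + s) \<le> g k * \<rho> k"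
    proof (cases "k \<in> J")
      case False
      then have "\<gamma> k = 0" using \<gamma>[of k] by (simp add: J_def)
      then show ?thesis using out[OF False] by simp
    next
      case True
      have "s = (\<Sum>i\<in>UNIV. (if i = k then g k * \<rho> k / \<gamma> k else 0) - F i k * \<rho> i)"
        using A\<rho>[of k] True unfolding b_def
        by (subst sum.cong[OF refl, where h = "\<lambda>i. A i k * \<rho> i"]) (auto simp: A_def out algebra_simps)
      then have "s = g k * \<rho> k / \<gamma> k - (\<Sum>i\<in>UNIV. F i k * \<rho> i)"
        by (simp add: sum_subtractf)
      then show ?thesis using True by (simp add: J_def field_simps)
    qed
  qed
qed


section \<open>Uplink rates under successive interference cancellation\<close>

lemma det_cov_Re_pos:
  fixes H :: "complex ^ 'k::finite ^ 'm::finite"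
  assumes "\<And>i. c i \<ge> 0"
  shows "Re (det (cov c H)) > 0"
proof -
  obtain r where "r > 0" "det (cov c H) = of_real r"
    using det_cov_pos[of c H] assms by blast
  then show ?thesis by simp
qed

lemma norm_smult: "norm (a *s w) = cmod a * norm w" for w :: "complex ^ 'm"
  by (simp add: norm_vec_def norm_mult L2_set_right_distrib)

text \<open>
  The load seen after decoding the users at positions \<open>\<ge> n\<close>: these have been cancelled up to their
  distortion. Uplink decoding thus runs in the reverse of the encoding order.
\<close>

definition sic_load :: "real \<Rightarrow> real \<Rightarrow> ('k \<Rightarrow> real) \<Rightarrow> ('k \<Rightarrow> nat) \<Rightarrow> nat \<Rightarrow> 'k \<Rightarrow> real"
  where "sic_load \<kappa> s \<rho> ord n i = (if ord i < n then \<rho> i else (1 - \<kappa>) * \<rho> i) / s"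

text \<open>Moving the threshold from \<open>n\<close> to \<open>Suc n\<close> raises the load of
  the user at position \<open>n\<close> by \<open>\<kappa> * \<rho> k / s\<close>, which multiplies
  the determinant by one plus its SINR. A position held by no user leaves both sides
  unchanged.\<close>

lemma sum_log_sic:
  fixes H :: "complex ^ 'k::finite ^ 'm::finite"
  assumes "inj ord" "s > 0" "0 \<le> \<kappa>" "\<kappa> \<le> 1" and \<rho>: "\<And>i. \<rho> i \<ge> 0"
    and u: "\<And>k. cov (sic_load \<kappa> s \<rho> ord (ord k)) H *v u k = column k H"
  shows "(\<Sum>k | ord k < n. log 2 (1 + \<kappa> * \<rho> k / s * power_form (sic_load \<kappa> s \<rho> ord (ord k)) H (u k)))
    = log2_det (cov (sic_load \<kappa> s \<rho> ord n) H) - log2_det (cov (sic_load \<kappa> s \<rho> ord 0) H)"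
proof (induction n)
  case 0
  then show ?case by simp
next
  case (Suc n)
  let ?c = "sic_load \<kappa> s \<rho> ord"
  have c: "?c n i \<ge> 0" for n i
    using assms by (simp add: sic_load_def)
  show ?case
  proof (cases "n \<in> range ord")
    case False
    then have "ord i < Suc n \<longleftrightarrow> ord i < n" for i
      by (metis less_Suc_eq rangeI)
    then have "?c (Suc n) = ?c n" "{k. ord k < Suc n} = {k. ord k < n}"
      by (auto simp: sic_load_def)
    then show ?thesis using Suc.IH by simp
  next
    case True
    then obtain k where k: "ord k = n" by auto
    let ?g = "\<kappa> * \<rho> k / s * power_form (?c (ord k)) H (u k)"
    have "{k. ord k < Suc n} = insert k {k. ord k < n}"
      using k \<open>inj ord\<close> by (auto simp: less_Suc_eq inj_eq dest: injD)
    moreover have "det (cov (?c (Suc n)) H) = det (cov (?c n) H) * of_real (1 + ?g)"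
      unfolding k[symmetric]
    proof (rule det_cov_add_user[OF u])
      show "?c (Suc (ord k)) k = ?c (ord k) k + \<kappa> * \<rho> k / s"
        using \<open>s > 0\<close> by (simp add: sic_load_def field_simps)
      show "?c (Suc (ord k)) i = ?c (ord k) i" if "i \<noteq> k" for i
        using that injD[OF \<open>inj ord\<close>, of i k] by (auto simp: sic_load_def less_Suc_eq)
    qed
    then have "Re (det (cov (?c (Suc n)) H)) = Re (det (cov (?c n) H)) * (1 + ?g)"
      by simp
    moreover have "?g \<ge> 0"
      using assms c by (intro mult_nonneg_nonneg divide_nonneg_pos power_form_nonneg) auto
    ultimately show ?thesis
      using Suc.IH k det_cov_Re_pos[of "?c n" H, OF c]
      by (simp add: log2_det_def log_mult)
  qed
qed

definition ul_rate :: "real \<Rightarrow> real \<Rightarrow> complex ^ 'k::finite ^ 'm \<Rightarrow> ('k \<Rightarrow> real) \<Rightarrow> real"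
  where "ul_rate \<kappa> s H \<rho> = log2_det (cov (\<lambda>i. 1 / s * \<rho> i) H) - log2_det (cov (\<lambda>i. (1 - \<kappa>) / s * \<rho> i) H)"

text \<open>In the downlink, \<open>i\<close> disturbs \<open>k\<close> with its full power if
  encoded later and with its distortion otherwise, including \<open>i = k\<close>. The uplink uses
  the same weights with the two users exchanged, which is where the duality enters.\<close>

definition interference_weight :: "real \<Rightarrow> ('k \<Rightarrow> nat) \<Rightarrow> 'k \<Rightarrow> 'k \<Rightarrow> real"
  where "interference_weight \<kappa> ord k i = (if ord k < ord i then 1 else 1 - \<kappa>)"

text \<open>Here \<open>\<gamma> k\<close> is the SINR of user \<open>k\<close> with the optimal
  filter. The bound for arbitrary \<open>w\<close> serves the passage from downlink to uplink, and
  the unit-norm filter attaining it serves the converse.\<close>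

lemma uplink_sinr:
  fixes H :: "complex ^ 'k::finite ^ 'm::finite"
  assumes "inj ord" "s > 0" "0 \<le> \<kappa>" "\<kappa> \<le> 1" and \<rho>: "\<And>i. \<rho> i \<ge> 0"
  obtains \<gamma> where "\<And>k. \<gamma> k \<ge> 0" "(\<Sum>k\<in>UNIV. log 2 (1 + \<gamma> k)) = ul_rate \<kappa> s H \<rho>"
    "\<And>k w. \<kappa> * (cmod (herm_prod (column k H) w))\<^sup>2 * \<rho> k \<le> \<gamma> k *
      ((\<Sum>i\<in>UNIV. interference_weight \<kappa> ord i k * (cmod (herm_prod (column i H) w))\<^sup>2 * \<rho> i) + s * (norm w)\<^sup>2)"
    "\<And>k. \<exists>w. norm w = 1 \<and> \<kappa> * (cmod (herm_prod (column k H) w))\<^sup>2 * \<rho> k = \<gamma> k *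
      ((\<Sum>i\<in>UNIV. interference_weight \<kappa> ord i k * (cmod (herm_prod (column i H) w))\<^sup>2 * \<rho> i) + s)"
proof -
  let ?c = "sic_load \<kappa> s \<rho> ord"
  have c: "?c n i \<ge> 0" for n i
    using assms by (simp add: sic_load_def)
  have "\<exists>u. cov (?c (ord k)) H *v u = column k H" for k
    using cov_solvable[of "?c (ord k)" H "column k H", OF c] by blast
  then obtain u where u: "\<And>k. cov (?c (ord k)) H *v u k = column k H"
    by metis
  define e where "e k = power_form (?c (ord k)) H (u k)" for k
  have e: "e k \<ge> 0" for k
    unfolding e_def using c by (rule power_form_nonneg)
  define \<gamma> where "\<gamma> k = \<kappa> * \<rho> k / s * e k" for k
  have \<gamma>: "\<gamma> k \<ge> 0" for k
    using assms e by (simp add: \<gamma>_def)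
  \<comment> \<open>Noise plus interference at the filter output is \<open>s\<close> times the form
    of the load that remains when user \<open>k\<close> has been decoded.\<close>
  have pf: "(\<Sum>i\<in>UNIV. interference_weight \<kappa> ord i k * (cmod (herm_prod (column i H) w))\<^sup>2 * \<rho> i) + s * (norm w)\<^sup>2
      = s * power_form (?c (ord k)) H w" for k w
  proof -
    have weight: "s * (?c (ord k) i * x) = interference_weight \<kappa> ord i k * x * \<rho> i" for i x
      using \<open>s > 0\<close> by (simp add: sic_load_def interference_weight_def)
    show ?thesis
      unfolding power_form_def distrib_left sum_distrib_left weight by (simp only: add.commute)
  qed
  have sinr: "\<kappa> * (cmod (herm_prod (column k H) w))\<^sup>2 * \<rho> k \<le> \<gamma> k * (s * power_form (?c (ord k)) H w)" for k w
  proof -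
    have "\<kappa> * \<rho> k * (cmod (herm_prod (column k H) w))\<^sup>2 \<le> \<kappa> * \<rho> k * (e k * power_form (?c (ord k)) H w)"
      unfolding e_def using assms c by (intro mult_left_mono cauchy_schwarz_cov u) auto
    then show ?thesis
      using \<open>s > 0\<close> by (simp add: \<gamma>_def mult_ac)
  qed
  have attained: "\<exists>w. norm w = 1 \<and> \<kappa> * (cmod (herm_prod (column k H) w))\<^sup>2 * \<rho> k = \<gamma> k * (s * power_form (?c (ord k)) H w)" for k
  proof (cases "u k = 0")
    case True
    \<comment> \<open>For a zero channel both sides vanish, so any unit vector serves.\<close>
    then have "column k H = 0" using u[of k] by simp
    moreover have "e k = 0" using True by (simp add: e_def power_form_def)
    moreover have "norm (axis undefined 1 :: complex ^ 'm) = 1" by simp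
    ultimately show ?thesis
      by (intro exI[of _ "axis undefined 1"]) (simp add: \<gamma>_def)
  next
    case False
    \<comment> \<open>The optimal filter is scaled to unit norm; both sides of the equation scale
      with \<open>a\<close> squared.\<close>
    define a where "a = inverse (norm (u k))"
    define w where "w = complex_of_real a *s u k"
    have "a > 0" using False by (simp add: a_def)
    have norm_w: "(norm w)\<^sup>2 = a\<^sup>2 * (norm (u k))\<^sup>2" "norm w = 1"
      using False \<open>a > 0\<close> by (simp_all add: w_def norm_smult power_mult_distrib) (simp add: a_def)
    have h: "(cmod (herm_prod h w))\<^sup>2 = a\<^sup>2 * (cmod (herm_prod h (u k)))\<^sup>2" for h
      using \<open>a > 0\<close> by (simp add: w_def herm_prod_scale norm_mult power_mult_distrib)
    have "power_form (?c (ord k)) H w = a\<^sup>2 * e k"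
      by (simp add: power_form_def e_def h norm_w(1) sum_distrib_left algebra_simps)
    moreover have "(cmod (herm_prod (column k H) w))\<^sup>2 = a\<^sup>2 * (e k)\<^sup>2"
      unfolding h herm_prod_solution[OF u] by (simp add: e_def)
    ultimately show ?thesis
      using norm_w(2) \<open>s > 0\<close>
      by (intro exI[of _ w]) (simp add: \<gamma>_def power2_eq_square)
  qed
  \<comment> \<open>A threshold beyond every position leaves all users at full power, while
    threshold 0 leaves only distortion. These are the two determinants of
    \<open>ul_rate\<close>.\<close>
  have "{k. ord k < Suc (Max (range ord))} = UNIV"
    by (auto simp: less_Suc_eq_le)
  then have "(\<Sum>k\<in>UNIV. log 2 (1 + \<gamma> k))
      = log2_det (cov (?c (Suc (Max (range ord)))) H) - log2_det (cov (?c 0) H)"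
    using sum_log_sic[OF assms u, of "Suc (Max (range ord))"] by (simp add: \<gamma>_def e_def)
  also have "?c (Suc (Max (range ord))) = (\<lambda>i. 1 / s * \<rho> i)"
    by (auto simp: sic_load_def less_Suc_eq_le)
  also have "?c 0 = (\<lambda>i. (1 - \<kappa>) / s * \<rho> i)"
    by (simp add: sic_load_def fun_eq_iff)
  finally have sum: "(\<Sum>k\<in>UNIV. log 2 (1 + \<gamma> k)) = ul_rate \<kappa> s H \<rho>"
    by (simp add: ul_rate_def)
  show ?thesis
  proof (rule that[OF \<gamma> sum])
    show "\<kappa> * (cmod (herm_prod (column k H) w))\<^sup>2 * \<rho> k \<le> \<gamma> k *
      ((\<Sum>i\<in>UNIV. interference_weight \<kappa> ord i k * (cmod (herm_prod (column i H) w))\<^sup>2 * \<rho> i) + s * (norm w)\<^sup>2)" for k w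
      unfolding pf by (rule sinr)
    show "\<exists>w. norm w = 1 \<and> \<kappa> * (cmod (herm_prod (column k H) w))\<^sup>2 * \<rho> k = \<gamma> k *
      ((\<Sum>i\<in>UNIV. interference_weight \<kappa> ord i k * (cmod (herm_prod (column i H) w))\<^sup>2 * \<rho> i) + s)" for k
    proof -
      obtain w where "norm w = 1"
        "\<kappa> * (cmod (herm_prod (column k H) w))\<^sup>2 * \<rho> k = \<gamma> k * (s * power_form (?c (ord k)) H w)"
        using attained by blast
      then show ?thesis
        using pf[of k w] by (intro exI[of _ w]) simp
    qed
  qed
qed

section \<open>Uplink-downlink duality on one subcarrier\<close>

lemma dl_sinr_eq:
  "dl_sinr \<kappa> s H ord p k = \<kappa> * (cmod (herm_prod (column k H) (p k)))\<^sup>2 /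
    ((\<Sum>i\<in>UNIV. interference_weight \<kappa> ord k i * (cmod (herm_prod (column k H) (p i)))\<^sup>2) + s)"
proof -
  let ?f = "\<lambda>i. (cmod (herm_prod (column k H) (p i)))\<^sup>2"
  have "(\<Sum>i\<in>UNIV. interference_weight \<kappa> ord k i * ?f i)
      = (\<Sum>i\<in>{i. ord k < ord i} \<union> {i. ord i \<le> ord k}. interference_weight \<kappa> ord k i * ?f i)"
    by (rule sum.cong) auto
  also have "\<dots> = (\<Sum>i | ord k < ord i. ?f i) + (1 - \<kappa>) * (\<Sum>i | ord i \<le> ord k. ?f i)"
    by (subst sum.union_disjoint) (auto simp: interference_weight_def sum_distrib_left intro!: sum.cong)
  finally show ?thesis
    by (simp add: dl_sinr_def)
qed

lemma interference_weight_nonneg: "\<kappa> \<le> 1 \<Longrightarrow> interference_weight \<kappa> ord k i \<ge> 0"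
  by (simp add: interference_weight_def)

lemma sum_log_mono:
  fixes a b :: "'k \<Rightarrow> real"
  assumes "\<And>k. 0 \<le> a k" "\<And>k. a k \<le> b k"
  shows "(\<Sum>k\<in>A. log 2 (1 + a k)) \<le> (\<Sum>k\<in>A. log 2 (1 + b k))"
proof (rule sum_mono)
  fix k
  show "log 2 (1 + a k) \<le> log 2 (1 + b k)"
    using assms(1)[of k] assms(2)[of k] by simp
qed

text \<open>The precoding directions serve as uplink filters. Power duality reproduces the downlink
  SINRs with these filters, and optimal filters can only improve on them.\<close>

lemma uplink_at_least_downlink:
  fixes H :: "complex ^ 'k::finite ^ 'm::finite"
  assumes "inj ord" "s > 0" "0 \<le> \<kappa>" "\<kappa> \<le> 1"
  obtains \<rho> where "\<And>i. \<rho> i \<ge> 0" "(\<Sum>i\<in>UNIV. \<rho> i) \<le> (\<Sum>i\<in>UNIV. (norm (p i))\<^sup>2)"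
    "(\<Sum>k\<in>UNIV. log 2 (1 + dl_sinr \<kappa> s H ord p k)) \<le> ul_rate \<kappa> s H \<rho>"
proof -
  have "\<exists>w. norm w = 1 \<and> p i = complex_of_real (norm (p i)) *s w" for i
  proof (cases "p i = 0")
    case True
    then show ?thesis
      by (intro exI[of _ "axis undefined 1"]) simp
  next
    case False
    let ?w = "complex_of_real (inverse (norm (p i))) *s p i"
    have "norm ?w = 1" "p i = complex_of_real (norm (p i)) *s ?w"
      using False by (simp_all add: norm_smult norm_inverse vec.scale_scale flip: of_real_mult)
    then show ?thesis by blast
  qed
  then obtain w where w: "\<And>i. norm (w i) = 1" "\<And>i. p i = complex_of_real (norm (p i)) *s w i"
    by metis
  define G where "G k i = (cmod (herm_prod (column k H) (w i)))\<^sup>2" for k i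
  have G: "(cmod (herm_prod (column k H) (p i)))\<^sup>2 = G k i * (norm (p i))\<^sup>2" for k i
    by (subst w(2)) (simp add: herm_prod_scale norm_mult power_mult_distrib G_def)
  define F where "F k i = interference_weight \<kappa> ord k i * G k i" for k i
  have F: "F k i \<ge> 0" for k i
    using assms by (simp add: F_def G_def interference_weight_nonneg)
  define \<gamma> where "\<gamma> = dl_sinr \<kappa> s H ord p"
  have load: "(\<Sum>i\<in>UNIV. F k i * (norm (p i))\<^sup>2) + s > 0" for k
    using F \<open>s > 0\<close> by (intro add_nonneg_pos sum_nonneg) auto
  have \<gamma>: "\<gamma> k = \<kappa> * G k k * (norm (p k))\<^sup>2 / ((\<Sum>i\<in>UNIV. F k i * (norm (p i))\<^sup>2) + s)" for k
    by (simp add: \<gamma>_def dl_sinr_eq G F_def mult.assoc)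
  have \<gamma>0: "\<gamma> k \<ge> 0" for k
    using load[of k] assms by (simp add: \<gamma> G_def)
  obtain \<rho> where \<rho>: "\<And>k. \<rho> k \<ge> 0" "(\<Sum>k\<in>UNIV. \<rho> k) \<le> (\<Sum>k\<in>UNIV. (norm (p k))\<^sup>2)"
    "\<And>k. \<gamma> k * ((\<Sum>i\<in>UNIV. F i k * \<rho> i) + s) \<le> \<kappa> * G k k * \<rho> k"
  \<comment> \<open>The downlink powers meet their own SINRs with equality, so they play the role of
    \<open>q\<close>.\<close>
  proof (rule power_duality[of F \<gamma> s "\<lambda>k. (norm (p k))\<^sup>2" "\<lambda>k. \<kappa> * G k k"])
    show "\<gamma> k * ((\<Sum>i\<in>UNIV. F k i * (norm (p i))\<^sup>2) + s) \<le> \<kappa> * G k k * (norm (p k))\<^sup>2" for k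
      using load[of k] by (simp add: \<gamma>)
  qed (use F \<gamma>0 \<open>s > 0\<close> in auto)
  obtain \<gamma>' where \<gamma>': "(\<Sum>k\<in>UNIV. log 2 (1 + \<gamma>' k)) = ul_rate \<kappa> s H \<rho>"
    "\<And>k w. \<kappa> * (cmod (herm_prod (column k H) w))\<^sup>2 * \<rho> k \<le> \<gamma>' k *
      ((\<Sum>i\<in>UNIV. interference_weight \<kappa> ord i k * (cmod (herm_prod (column i H) w))\<^sup>2 * \<rho> i) + s * (norm w)\<^sup>2)"
    by (rule uplink_sinr[where \<rho> = \<rho> and H = H, OF assms \<rho>(1)]) (rule that; assumption)
  \<comment> \<open>\<open>w k\<close> is one admissible uplink filter, so what it reaches is at
    most the optimal SINR \<open>\<gamma>' k\<close>.\<close>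
  have "\<gamma> k \<le> \<gamma>' k" for k
  proof (rule mult_right_le_imp_le)
    show "\<gamma> k * ((\<Sum>i\<in>UNIV. F i k * \<rho> i) + s) \<le> \<gamma>' k * ((\<Sum>i\<in>UNIV. F i k * \<rho> i) + s)"
      using \<rho>(3)[of k] \<gamma>'(2)[of k "w k"] by (simp add: F_def G_def w(1))
    show "0 < (\<Sum>i\<in>UNIV. F i k * \<rho> i) + s"
      using F \<rho> \<open>s > 0\<close> by (intro add_nonneg_pos sum_nonneg) auto
  qed
  then have "(\<Sum>k\<in>UNIV. log 2 (1 + \<gamma> k)) \<le> (\<Sum>k\<in>UNIV. log 2 (1 + \<gamma>' k))"
    by (intro sum_log_mono \<gamma>0)
  then show ?thesis
    using that[of \<rho>] \<rho>(1,2) unfolding \<gamma>'(1) \<gamma>_def by blast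
qed

text \<open>Conversely, the optimal uplink filters become precoding directions, for whatever
  injective \<open>ord\<close> is given.\<close>

lemma downlink_at_least_uplink:
  fixes H :: "complex ^ 'k::finite ^ 'm::finite"
  assumes "inj ord" "s > 0" "0 \<le> \<kappa>" "\<kappa> \<le> 1" and \<rho>: "\<And>i. \<rho> i \<ge> 0"
  obtains p where "(\<Sum>i\<in>UNIV. (norm (p i))\<^sup>2) \<le> (\<Sum>i\<in>UNIV. \<rho> i)"
    "ul_rate \<kappa> s H \<rho> \<le> (\<Sum>k\<in>UNIV. log 2 (1 + dl_sinr \<kappa> s H ord p k))"
proof -
  obtain \<gamma> where \<gamma>: "\<And>k. \<gamma> k \<ge> 0" "(\<Sum>k\<in>UNIV. log 2 (1 + \<gamma> k)) = ul_rate \<kappa> s H \<rho>"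
    "\<And>k. \<exists>w. norm w = 1 \<and> \<kappa> * (cmod (herm_prod (column k H) w))\<^sup>2 * \<rho> k = \<gamma> k *
      ((\<Sum>i\<in>UNIV. interference_weight \<kappa> ord i k * (cmod (herm_prod (column i H) w))\<^sup>2 * \<rho> i) + s)"
    by (rule uplink_sinr[where \<rho> = \<rho> and H = H, OF assms]) (rule that; assumption)
  define w where "w k = (SOME w. norm w = 1 \<and> \<kappa> * (cmod (herm_prod (column k H) w))\<^sup>2 * \<rho> k = \<gamma> k *
      ((\<Sum>i\<in>UNIV. interference_weight \<kappa> ord i k * (cmod (herm_prod (column i H) w))\<^sup>2 * \<rho> i) + s))" for k
  have w: "norm (w k) = 1" "\<kappa> * (cmod (herm_prod (column k H) (w k)))\<^sup>2 * \<rho> k = \<gamma> k *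
      ((\<Sum>i\<in>UNIV. interference_weight \<kappa> ord i k * (cmod (herm_prod (column i H) (w k)))\<^sup>2 * \<rho> i) + s)" for k
    using someI_ex[OF \<gamma>(3)[of k]] unfolding w_def by (rule conjunct1, rule conjunct2)
  define G where "G k i = (cmod (herm_prod (column k H) (w i)))\<^sup>2" for k i
  define F where "F k i = interference_weight \<kappa> ord k i * G k i" for k i
  have F: "F k i \<ge> 0" for k i
    using assms by (simp add: F_def G_def interference_weight_nonneg)
  obtain q where q: "\<And>k. q k \<ge> 0" "(\<Sum>k\<in>UNIV. q k) \<le> (\<Sum>k\<in>UNIV. \<rho> k)"
    "\<And>k. \<gamma> k * ((\<Sum>i\<in>UNIV. F k i * q i) + s) \<le> \<kappa> * G k k * q k"
  \<comment> \<open>The uplink coupling is the transpose of \<open>F\<close>, so the powers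
    \<open>q\<close> obtained here belong to the downlink coupling \<open>F\<close> itself.\<close>
  proof (rule power_duality[of "\<lambda>k i. F i k" \<gamma> s \<rho> "\<lambda>k. \<kappa> * G k k"])
    show "\<gamma> k * ((\<Sum>i\<in>UNIV. F i k * \<rho> i) + s) \<le> \<kappa> * G k k * \<rho> k" for k
      using w(2)[of k] by (simp add: F_def G_def)
  qed (use F \<gamma>(1) \<rho> \<open>s > 0\<close> in auto)
  define p where "p i = complex_of_real (sqrt (q i)) *s w i" for i
  have G: "(cmod (herm_prod h (p i)))\<^sup>2 = (cmod (herm_prod h (w i)))\<^sup>2 * q i" for h i
    using q(1) by (simp add: p_def herm_prod_scale norm_mult power_mult_distrib)
  have norm_p: "(norm (p i))\<^sup>2 = q i" for i
    using q(1) by (simp add: p_def norm_smult w)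
  have "\<gamma> k \<le> dl_sinr \<kappa> s H ord p k" for k
  proof -
    have "(\<Sum>i\<in>UNIV. F k i * q i) + s > 0"
      using F q \<open>s > 0\<close> by (intro add_nonneg_pos sum_nonneg) auto
    then show ?thesis
      using q(3)[of k] by (simp add: dl_sinr_eq G pos_le_divide_eq F_def G_def mult.assoc)
  qed
  then have "(\<Sum>k\<in>UNIV. log 2 (1 + \<gamma> k)) \<le> (\<Sum>k\<in>UNIV. log 2 (1 + dl_sinr \<kappa> s H ord p k))"
    by (intro sum_log_mono \<gamma>(1))
  then show ?thesis
    using that[of p] q(2) unfolding \<gamma>(2) norm_p by blast
qed

section \<open>The uplink problem as a problem in user powers\<close>

lemma ul_matrix_diagonal:
  assumes "is_diagonal D"
  shows "ul_matrix c H D = cov (\<lambda>i. c * D $ i $ i) H"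
proof -
  have "(\<Sum>j\<in>UNIV. H $ a $ j * complex_of_real (D $ j $ i)) = H $ a $ i * complex_of_real (D $ i $ i)" for a i
  proof -
    have "(\<Sum>j\<in>UNIV. H $ a $ j * complex_of_real (D $ j $ i))
        = (\<Sum>j\<in>UNIV. if j = i then H $ a $ i * complex_of_real (D $ i $ i) else 0)"
      using assms by (intro sum.cong) (auto simp: is_diagonal_def)
    then show ?thesis by simp
  qed
  then show ?thesis
    by (simp add: ul_matrix_def cov_def vec_eq_iff mat_def matrix_matrix_mult_def map_matrix_def
        conj_transpose_def transpose_def)
      (simp add: scaleR_conv_of_real sum_distrib_left mult_ac)
qed

lemma is_psd_diagonal:
  assumes "is_diagonal D"
  shows "is_psd D \<longleftrightarrow> (\<forall>i. D $ i $ i \<ge> 0)"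
proof -
  have tr: "transpose D = D"
    using assms by (auto simp: vec_eq_iff transpose_def is_diagonal_def) metis
  have quad: "x \<bullet> (D *v x) = (\<Sum>i\<in>UNIV. D $ i $ i * (x $ i)\<^sup>2)" for x
  proof -
    have "(D *v x) $ i = D $ i $ i * x $ i" for i
    proof -
      have "(\<Sum>j\<in>UNIV. D $ i $ j * x $ j) = (\<Sum>j\<in>UNIV. if j = i then D $ i $ i * x $ i else 0)"
        using assms by (intro sum.cong) (auto simp: is_diagonal_def)
      then show ?thesis by (simp add: matrix_vector_mult_def)
    qed
    then show ?thesis
      by (simp add: inner_vec_def power2_eq_square mult_ac)
  qed
  have "D $ i $ i \<ge> 0" if "is_psd D" for i
  proof -
    have "axis i 1 \<bullet> (D *v axis i 1) = (\<Sum>j\<in>UNIV. if j = i then D $ i $ i else 0)"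
      unfolding quad by (rule sum.cong) (auto simp: axis_def)
    then have "axis i 1 \<bullet> (D *v axis i 1) = D $ i $ i" by simp
    then show ?thesis
      using that unfolding is_psd_def by metis
  qed
  then show ?thesis
    by (auto simp: is_psd_def tr quad intro!: sum_nonneg)
qed

lemma ul_rate_in_ul_values:
  fixes H :: "nat \<Rightarrow> complex ^ 'k::finite ^ 'm::finite"
  assumes "\<And>\<nu> i. \<nu> < S \<Longrightarrow> \<rho> \<nu> i \<ge> 0" "(\<Sum>\<nu><S. \<Sum>i\<in>UNIV. \<rho> \<nu> i) \<le> P"
  shows "1 / real S * (\<Sum>\<nu><S. ul_rate \<kappa> s (H \<nu>) (\<rho> \<nu>)) \<in> ul_values S \<kappa> s P H"
proof -
  define D :: "nat \<Rightarrow> real ^ 'k ^ 'k" where "D \<nu> = (\<chi> i j. if i = j then \<rho> \<nu> i else 0)" for \<nu>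
  have diag: "is_diagonal (D \<nu>)" for \<nu>
    by (simp add: is_diagonal_def D_def)
  have "ul_feasible S P D"
    using assms by (simp add: ul_feasible_def diag is_psd_diagonal trace_def) (simp add: D_def)
  moreover have "ul_objective S \<kappa> s H D = 1 / real S * (\<Sum>\<nu><S. ul_rate \<kappa> s (H \<nu>) (\<rho> \<nu>))"
    by (simp add: ul_objective_def ul_rate_def ul_matrix_diagonal diag) (simp add: D_def)
  ultimately show ?thesis
    unfolding ul_values_def by force
qed

text \<open>
  Powers on the irrelevant subcarriers \<open>\<nu> \<ge> S\<close> are bounded as well, which makes this set compact in the
  product topology.
\<close>

definition power_allocations :: "nat \<Rightarrow> real \<Rightarrow> (nat \<Rightarrow> 'k::finite \<Rightarrow> real) set"
  where "power_allocations S P =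
    {\<rho>. (\<forall>\<nu> i. 0 \<le> \<rho> \<nu> i \<and> \<rho> \<nu> i \<le> P) \<and> (\<Sum>\<nu><S. \<Sum>i\<in>UNIV. \<rho> \<nu> i) \<le> P}"

text \<open>Replaces the feasible matrices by a compact set of powers. The bound of each entry by
  \<open>P\<close> follows from nonnegativity and the total power constraint.\<close>

lemma ul_values_eq:
  fixes H :: "nat \<Rightarrow> complex ^ 'k::finite ^ 'm::finite"
  assumes "P > 0"
  shows "ul_values S \<kappa> s P H = (\<lambda>\<rho>. 1 / real S * (\<Sum>\<nu><S. ul_rate \<kappa> s (H \<nu>) (\<rho> \<nu>))) ` power_allocations S P"
proof (intro equalityI subsetI)
  fix v assume "v \<in> ul_values S \<kappa> s P H"
  then obtain D where D: "ul_feasible S P D" and v: "v = ul_objective S \<kappa> s H D"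
    by (auto simp: ul_values_def)
  \<comment> \<open>The matrices are unconstrained for \<open>\<nu>\<close> from \<open>S\<close>
    on, so zero is substituted there; the objective does not see these entries.\<close>
  define \<rho> where "\<rho> \<nu> i = (if \<nu> < S then D \<nu> $ i $ i else 0)" for \<nu> i
  have "\<rho> \<nu> i \<ge> 0" for \<nu> i
    using D is_psd_diagonal[of "D \<nu>"] by (auto simp: \<rho>_def ul_feasible_def)
  moreover have total: "(\<Sum>\<nu><S. \<Sum>i\<in>UNIV. \<rho> \<nu> i) \<le> P"
    using D by (simp add: ul_feasible_def trace_def \<rho>_def)
  moreover have "\<rho> \<nu> i \<le> P" for \<nu> i
  proof (cases "\<nu> < S")
    case True
    have "\<rho> \<nu> i \<le> (\<Sum>i\<in>UNIV. \<rho> \<nu> i)"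
      using \<open>\<And>\<nu> i. \<rho> \<nu> i \<ge> 0\<close> by (intro member_le_sum) auto
    also have "\<dots> \<le> (\<Sum>\<nu><S. \<Sum>i\<in>UNIV. \<rho> \<nu> i)"
      using True \<open>\<And>\<nu> i. \<rho> \<nu> i \<ge> 0\<close>
      by (intro member_le_sum[where f = "\<lambda>\<nu>. \<Sum>i\<in>UNIV. \<rho> \<nu> i"]) (auto intro: sum_nonneg)
    finally show ?thesis using total by simp
  qed (use assms in \<open>simp add: \<rho>_def\<close>)
  ultimately have "\<rho> \<in> power_allocations S P"
    by (simp add: power_allocations_def)
  moreover have "v = 1 / real S * (\<Sum>\<nu><S. ul_rate \<kappa> s (H \<nu>) (\<rho> \<nu>))"
    using D by (simp add: v ul_objective_def ul_rate_def ul_feasible_def ul_matrix_diagonal \<rho>_def)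
  ultimately show "v \<in> (\<lambda>\<rho>. 1 / real S * (\<Sum>\<nu><S. ul_rate \<kappa> s (H \<nu>) (\<rho> \<nu>))) ` power_allocations S P"
    by blast
next
  fix v assume "v \<in> (\<lambda>\<rho>. 1 / real S * (\<Sum>\<nu><S. ul_rate \<kappa> s (H \<nu>) (\<rho> \<nu>))) ` power_allocations S P"
  then obtain \<rho> where \<rho>: "\<rho> \<in> power_allocations S P"
    and v: "v = 1 / real S * (\<Sum>\<nu><S. ul_rate \<kappa> s (H \<nu>) (\<rho> \<nu>))"
    by auto
  show "v \<in> ul_values S \<kappa> s P H"
    unfolding v by (rule ul_rate_in_ul_values) (use \<rho> in \<open>simp_all add: power_allocations_def\<close>)
qed

section \<open>Compactness and existence of the uplink maximum\<close>

text \<open>Tychonoff's theorem, transferred to the topology of the function type.\<close>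

lemma compact_function_set:
  fixes A :: "'a \<Rightarrow> 'b::topological_space set"
  assumes "\<And>i. compact (A i)"
  shows "compact {f. \<forall>i. f i \<in> A i}"
proof -
  have "compactin (product_topology (\<lambda>i. euclidean) UNIV) (Pi\<^sub>E UNIV A)"
    using assms by (simp add: compactin_PiE)
  moreover have "Pi\<^sub>E UNIV A = {f. \<forall>i. f i \<in> A i}"
    by (auto simp: PiE_def)
  ultimately show ?thesis
    by (simp add: euclidean_product_topology)
qed

lemma continuous_on_entry: "continuous_on X (\<lambda>\<rho>. \<rho> \<nu> i)" for X :: "(nat \<Rightarrow> 'k \<Rightarrow> real) set"
  by (intro continuous_on_product_then_coordinatewise[where f = "\<lambda>\<rho>. \<rho> \<nu>"]
      continuous_on_product_then_coordinatewise[where f = "\<lambda>\<rho>. \<rho>"] continuous_on_id)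

text \<open>Tychonoff is applied twice, over users and over subcarriers; the total power constraint
  then cuts out a closed subset.\<close>

lemma compact_power_allocations: "compact (power_allocations S P)"
proof -
  have "compact {\<rho> :: nat \<Rightarrow> 'a \<Rightarrow> real. \<forall>\<nu>. \<rho> \<nu> \<in> {f. \<forall>i. f i \<in> {0..P}}}"
    by (intro compact_function_set compact_Icc)
  moreover have "closed {\<rho> :: nat \<Rightarrow> 'a \<Rightarrow> real. (\<Sum>\<nu><S. \<Sum>i\<in>UNIV. \<rho> \<nu> i) \<le> P}"
    by (intro closed_Collect_le continuous_intros continuous_on_entry)
  ultimately have "compact ({\<rho> :: nat \<Rightarrow> 'a \<Rightarrow> real. \<forall>\<nu>. \<rho> \<nu> \<in> {f. \<forall>i. f i \<in> {0..P}}}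
      \<inter> {\<rho>. (\<Sum>\<nu><S. \<Sum>i\<in>UNIV. \<rho> \<nu> i) \<le> P})"
    by (rule compact_Int_closed)
  also have "\<dots> = power_allocations S P"
    by (auto simp: power_allocations_def)
  finally show ?thesis .
qed

text \<open>The determinant is a polynomial in the powers and is positive on the feasible set, so
  its logarithm is continuous there.\<close>

lemma continuous_on_log2_det:
  fixes H :: "complex ^ 'k::finite ^ 'm::finite"
  assumes "a \<ge> 0"
  shows "continuous_on (power_allocations S P) (\<lambda>\<rho>. log2_det (cov (\<lambda>i. a * \<rho> \<nu> i) H))"
proof -
  have "continuous_on (power_allocations S P) (\<lambda>\<rho>. Re (det (cov (\<lambda>i. a * \<rho> \<nu> i) H)))"
    unfolding det_def cov_def vec_lambda_beta
    by (intro continuous_intros continuous_on_entry)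
  moreover have "Re (det (cov (\<lambda>i. a * \<rho> \<nu> i) H)) > 0" if "\<rho> \<in> power_allocations S P" for \<rho>
    using that assms by (intro det_cov_Re_pos) (simp add: power_allocations_def)
  ultimately show ?thesis
    unfolding log2_det_def by (intro continuous_on_log continuous_on_const) force+
qed

lemma ul_values_attain_maximum:
  fixes H :: "nat \<Rightarrow> complex ^ 'k::finite ^ 'm::finite"
  assumes "s > 0" "\<kappa> \<le> 1" "P > 0"
  obtains v where "is_maximum (ul_values S \<kappa> s P H) v"
proof -
  have "(\<lambda>\<nu> i. 0) \<in> (power_allocations S P :: (nat \<Rightarrow> 'k \<Rightarrow> real) set)"
    using assms by (simp add: power_allocations_def)
  then have "(power_allocations S P :: (nat \<Rightarrow> 'k \<Rightarrow> real) set) \<noteq> {}" by blast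
  moreover have "continuous_on (power_allocations S P) (\<lambda>\<rho>. 1 / real S * (\<Sum>\<nu><S. ul_rate \<kappa> s (H \<nu>) (\<rho> \<nu>)))"
    unfolding ul_rate_def using assms by (intro continuous_intros continuous_on_log2_det) auto
  ultimately obtain \<rho> where "\<rho> \<in> power_allocations S P"
    "\<forall>\<rho>'\<in>power_allocations S P. 1 / real S * (\<Sum>\<nu><S. ul_rate \<kappa> s (H \<nu>) (\<rho>' \<nu>))
        \<le> 1 / real S * (\<Sum>\<nu><S. ul_rate \<kappa> s (H \<nu>) (\<rho> \<nu>))"
    using continuous_attains_sup[OF compact_power_allocations] by meson
  then show ?thesis
    using that unfolding ul_values_eq[OF \<open>P > 0\<close>] is_maximum_def by blast
qed

section \<open>Equality of the two maxima\<close>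

lemma is_maximum_Sup: "is_maximum V v \<Longrightarrow> Sup V = v"
  unfolding is_maximum_def by (intro cSup_eq_maximum) auto

theorem lemma1:
  fixes H :: "nat \<Rightarrow> complex ^ 'k::finite ^ 'm::finite"
    and S :: nat and s2 Ptot EVM \<kappa> :: real
  assumes "S \<ge> 1" and "s2 > 0" and "Ptot > 0"
    and "0 \<le> EVM" and "EVM \<le> 1" and "\<kappa> = 1 - EVM\<^sup>2"
  shows "is_maximum (dl_rates S \<kappa> s2 Ptot H) (R_dl_dpc S \<kappa> s2 Ptot H)
    \<and> is_maximum (ul_values S \<kappa> s2 Ptot H) (ul_optimal_value S \<kappa> s2 Ptot H)
    \<and> R_dl_dpc S \<kappa> s2 Ptot H = ul_optimal_value S \<kappa> s2 Ptot H"
proof -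
  have \<kappa>: "0 \<le> \<kappa>" "\<kappa> \<le> 1"
    using assms by (auto simp: power_le_one)
  let ?obj = "\<lambda>\<rho>. 1 / real S * (\<Sum>\<nu><S. ul_rate \<kappa> s2 (H \<nu>) (\<rho> \<nu>))"
  have up: "\<exists>u\<in>ul_values S \<kappa> s2 Ptot H. v \<le> u" if v: "v \<in> dl_rates S \<kappa> s2 Ptot H" for v
  proof -
    obtain ord p where v: "v = dl_sum_rate S \<kappa> s2 H ord p" and feas: "dl_feasible S Ptot ord p"
      using v unfolding dl_rates_def by blast
    have "\<exists>\<rho>. (\<forall>i. \<rho> i \<ge> 0) \<and> (\<Sum>i\<in>UNIV. \<rho> i) \<le> (\<Sum>i\<in>UNIV. (norm (p \<nu> i))\<^sup>2) \<and>
        (\<Sum>k\<in>UNIV. log 2 (1 + dl_sinr \<kappa> s2 (H \<nu>) (ord \<nu>) (p \<nu>) k)) \<le> ul_rate \<kappa> s2 (H \<nu>) \<rho>" if "\<nu> < S" for \<nu>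
    proof -
      have "inj (ord \<nu>)"
        using feas that by (auto simp: dl_feasible_def encoding_order_def bij_betw_def)
      from uplink_at_least_downlink[OF this \<open>s2 > 0\<close> \<kappa>, of "p \<nu>" "H \<nu>"] show ?thesis
        by blast
    qed
    then obtain \<rho>' where \<rho>': "\<And>\<nu>. \<nu> < S \<Longrightarrow> (\<forall>i. \<rho>' \<nu> i \<ge> 0) \<and> (\<Sum>i\<in>UNIV. \<rho>' \<nu> i) \<le> (\<Sum>i\<in>UNIV. (norm (p \<nu> i))\<^sup>2) \<and>
        (\<Sum>k\<in>UNIV. log 2 (1 + dl_sinr \<kappa> s2 (H \<nu>) (ord \<nu>) (p \<nu>) k)) \<le> ul_rate \<kappa> s2 (H \<nu>) (\<rho>' \<nu>)"
      by metis
    have "(\<Sum>\<nu><S. \<Sum>i\<in>UNIV. \<rho>' \<nu> i) \<le> (\<Sum>\<nu><S. \<Sum>i\<in>UNIV. (norm (p \<nu> i))\<^sup>2)"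
      by (rule sum_mono) (use \<rho>' in auto)
    also have "\<dots> \<le> Ptot"
      using feas by (simp add: dl_feasible_def)
    finally have "?obj \<rho>' \<in> ul_values S \<kappa> s2 Ptot H"
      by (rule ul_rate_in_ul_values[rotated]) (use \<rho>' in blast)
    moreover have "v \<le> ?obj \<rho>'"
      unfolding v dl_sum_rate_def using \<rho>' by (intro mult_left_mono sum_mono) auto
    ultimately show ?thesis
      by blast
  qed
  have down: "\<exists>v\<in>dl_rates S \<kappa> s2 Ptot H. u \<le> v" if u: "u \<in> ul_values S \<kappa> s2 Ptot H" for u
  proof -
    obtain \<rho> where \<rho>: "\<rho> \<in> power_allocations S Ptot" and u: "u = ?obj \<rho>"
      using u unfolding ul_values_eq[OF \<open>Ptot > 0\<close>] by blast
    \<comment> \<open>The uplink rate does not depend on an order, so one arbitrary encoding order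
      is used on all subcarriers.\<close>
    obtain ord :: "'k \<Rightarrow> nat" where ord: "bij_betw ord UNIV {1..CARD('k)}"
      using finite_same_card_bij[of "UNIV :: 'k set" "{1..CARD('k)}"] by auto
    have "\<exists>p. (\<Sum>i\<in>UNIV. (norm (p i))\<^sup>2) \<le> (\<Sum>i\<in>UNIV. \<rho> \<nu> i) \<and>
        ul_rate \<kappa> s2 (H \<nu>) (\<rho> \<nu>) \<le> (\<Sum>k\<in>UNIV. log 2 (1 + dl_sinr \<kappa> s2 (H \<nu>) ord p k))" for \<nu>
    proof -
      have "inj ord" "\<And>i. \<rho> \<nu> i \<ge> 0"
        using ord \<rho> by (auto simp: bij_betw_def power_allocations_def)
      then obtain p where "(\<Sum>i\<in>UNIV. (norm (p i))\<^sup>2) \<le> (\<Sum>i\<in>UNIV. \<rho> \<nu> i)"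
        "ul_rate \<kappa> s2 (H \<nu>) (\<rho> \<nu>) \<le> (\<Sum>k\<in>UNIV. log 2 (1 + dl_sinr \<kappa> s2 (H \<nu>) ord p k))"
        by (rule downlink_at_least_uplink[OF _ \<open>s2 > 0\<close> \<kappa>])
      then show ?thesis by blast
    qed
    then obtain p where p: "\<And>\<nu>. (\<Sum>i\<in>UNIV. (norm (p \<nu> i))\<^sup>2) \<le> (\<Sum>i\<in>UNIV. \<rho> \<nu> i)"
        "\<And>\<nu>. ul_rate \<kappa> s2 (H \<nu>) (\<rho> \<nu>) \<le> (\<Sum>k\<in>UNIV. log 2 (1 + dl_sinr \<kappa> s2 (H \<nu>) ord (p \<nu>) k))"
      by metis
    have "(\<Sum>\<nu><S. \<Sum>i\<in>UNIV. (norm (p \<nu> i))\<^sup>2) \<le> (\<Sum>\<nu><S. \<Sum>i\<in>UNIV. \<rho> \<nu> i)"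
      by (rule sum_mono, rule p)
    then have "dl_feasible S Ptot (\<lambda>\<nu>. ord) p"
      using \<rho> ord by (simp add: dl_feasible_def encoding_order_def power_allocations_def)
    moreover have "u \<le> dl_sum_rate S \<kappa> s2 H (\<lambda>\<nu>. ord) p"
      unfolding u dl_sum_rate_def using p by (intro mult_left_mono sum_mono) auto
    ultimately show ?thesis
      unfolding dl_rates_def by blast
  qed
  obtain v where v: "is_maximum (ul_values S \<kappa> s2 Ptot H) v"
    using ul_values_attain_maximum[of s2 \<kappa> Ptot] assms \<kappa> by metis
  have "is_maximum (dl_rates S \<kappa> s2 Ptot H) v"
    unfolding is_maximum_def
  proof
    \<comment> \<open>Some downlink rate \<open>w\<close> is at least \<open>v\<close>. It is
      dominated by an uplink value, hence by \<open>v\<close>, so \<open>v = w\<close> is itself a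
      downlink rate.\<close>
    obtain w where w: "w \<in> dl_rates S \<kappa> s2 Ptot H" "v \<le> w"
      using v down unfolding is_maximum_def by blast
    then have "w \<le> v"
      using v up unfolding is_maximum_def by (meson order_trans)
    with w show "v \<in> dl_rates S \<kappa> s2 Ptot H"
      by simp
    show "\<forall>w\<in>dl_rates S \<kappa> s2 Ptot H. w \<le> v"
      using v up unfolding is_maximum_def by (meson order_trans)
  qed
  with v show ?thesis
    by (simp add: R_dl_dpc_def ul_optimal_value_def is_maximum_Sup)
qed

end
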